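(* Let $\lambda>0$ and let $\hat\beta$ be the square-root Lasso, i.e. a minimizer over $\beta\in\mathbb{R}^p$ of $\|Y-X\beta\|_n+\lambda\|\beta\|_1$, where $Y=X\beta^0+\epsilon$. Let $\lambda_0>0$ satisfy $\lambda_0\|\epsilon\|_n\ge\|\epsilon^TX\|_\infty/n$. Suppose that for $\eta=\sqrt2-1$ one has $\lambda\eta>\lambda_0$ and $$\|\beta^0\|_1\le\|\epsilon\|_n\Big(\frac{\lambda\eta-\lambda_0}{2\lambda_0\lambda}\Big).$$ Let $0\le\delta<1$ be arbitrary and define $$L:=\frac{\lambda\eta+\lambda_0+\delta(\lambda\eta-\lambda_0)}{(1-\delta)(\lambda\eta-\lambda_0)}.$$ Then $$2\delta(\lambda\eta-\lambda_0)\|\epsilon\|_n\|\hat\beta-\beta^0\|_1+\|X(\hat\beta-\beta^0)\|_n^2$$ $$\le\min_{S\subset\{1,\dots,p\}}\Big\{\min_{\beta\in\mathbb{R}^p,\ S_\beta=S}\Big[2\delta(\lambda\eta-\lambda_0)\|\epsilon\|_n\|\beta-\beta^0\|_1+\|X(\beta-\beta^0)\|_n^2\Big]$$ $$+\Big(\frac{\lambda\eta+\lambda_0+\delta(\lambda\eta-\lambda_0)}{\eta}\Big)^2\Big(\frac{\lambda\eta+\lambda_0}{2\lambda_0}\Big)^2\frac{\|\epsilon\|_n^2|S|}{\hat\phi^2(L,S)}\Big\}.$$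
   Context: $X$ is a fixed $n\times p$ real matrix of rank $n$, $Y\in\mathbb{R}^n$, $f^0=\mathbb{E}Y$, $\beta^0\in\mathbb{R}^p$ is a solution of $X\beta^0=f^0$, and $\epsilon:=Y-f^0$, so $Y=X\beta^0+\epsilon$ (the result is deterministic: it holds for any realization of $\epsilon$). For $v\in\mathbb{R}^n$, $\|v\|_n:=\sqrt{v^Tv/n}$. For $\beta\in\mathbb{R}^p$, $S_\beta:=\{j:\beta_j\ne0\}$. For $S\subset\{1,\dots,p\}$, $\beta_S\in\mathbb{R}^p$ has entries $\beta_j$ for $j\in S$ and $0$ otherwise. The compatibility constant, for $L>0$, is $$\hat\phi^2(L,S):=\min\{|S|\,\|X\beta_S-X\beta_{S^c}\|_n^2:\ \|\beta_S\|_1=1,\ \|\beta_{S^c}\|_1\le L\}.$$ Conventions: minima over $\beta$ with $S_\beta=S$ are understood as infima (i.e. the inequality holds for every $\beta$, with $S=S_\beta$); the term containing $|S|/\hat\phi^2(L,S)$ is $0$ if $S=\emptyset$ and $+\infty$ if $S\ne\emptyset$ and $\hat\phi(L,S)=0$. *)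

theory Defs
  imports "HOL-Analysis.Analysis"
begin

definition norm_n :: "real ^ 'n \<Rightarrow> real" where
  "norm_n v = sqrt ((v \<bullet> v) / real CARD('n))"

definition norm_l1 :: "real ^ 'p \<Rightarrow> real" where
  "norm_l1 b = (\<Sum>j\<in>UNIV. \<bar>b $ j\<bar>)"

definition active_set :: "real ^ 'p \<Rightarrow> 'p set" where
  "active_set b = {j. b $ j \<noteq> 0}"

definition restrict_vec :: "real ^ 'p \<Rightarrow> 'p set \<Rightarrow> real ^ 'p" where
  "restrict_vec b S = (\<chi> j. if j \<in> S then b $ j else 0)"

text \<open>The squared compatibility constant. For nonempty \<open>S\<close> and \<open>L \<ge> 0\<close> the feasible set is
  nonempty and compact, so the infimum is the minimum. For empty \<open>S\<close> no vector is feasible and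
  the value is meaningless; it is never used (see \<open>compat_term\<close>).\<close>

definition compat_sq :: "real ^ 'p ^ 'n \<Rightarrow> real \<Rightarrow> 'p set \<Rightarrow> real" where
  "compat_sq X L S =
     Inf {real (card S) * (norm_n (X *v restrict_vec b S - X *v restrict_vec b (- S)))\<^sup>2 | b.
          norm_l1 (restrict_vec b S) = 1 \<and> norm_l1 (restrict_vec b (- S)) \<le> L}"

text \<open>The value of \<open>c |S| / \<phi>\<^sup>2(L, S)\<close>, where \<open>\<phi>\<close> is the compatibility constant. The factor \<open>c\<close> is
  an argument because the whole term is infinite when the compatibility constant of a nonempty
  \<open>S\<close> vanishes, even if \<open>c = 0\<close>, whereas \<open>0 * \<infinity> = 0\<close> in \<^typ>\<open>ereal\<close>.\<close>

definition compat_term :: "real \<Rightarrow> real ^ 'p ^ 'n \<Rightarrow> real \<Rightarrow> 'p set \<Rightarrow> ereal" where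
  "compat_term c X L S =
     (if S = {} then 0
      else if compat_sq X L S = 0 then \<infinity>
      else ereal (c * real (card S) / compat_sq X L S))"

definition is_sqrt_lasso :: "real ^ 'p ^ 'n \<Rightarrow> real ^ 'n \<Rightarrow> real \<Rightarrow> real ^ 'p \<Rightarrow> bool" where
  "is_sqrt_lasso X Y lam bhat \<longleftrightarrow>
     is_arg_min (\<lambda>b. norm_n (Y - X *v b) + lam * norm_l1 b) (\<lambda>_. True) bhat"

end

theory Submission
  imports Defs
begin

text \<open>Write \<open>\<sigma> = \<parallel>\<epsilon>\<parallel>\<^sub>n\<close> and \<open>\<sigma>' = \<parallel>Y - X \<beta>hat\<parallel>\<^sub>n\<close>. Comparing the objective at \<open>\<beta>hat\<close> and \<open>\<beta>0\<close> gives
  \<open>\<sigma>' \<le> \<sigma> (lam \<eta> + lam0) / (2 lam0)\<close>; expanding \<open>\<sigma>'\<^sup>2\<close> and bounding the noise term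
  gives \<open>\<sigma>'\<^sup>2 \<ge> (1 - 2 \<eta>) \<sigma>\<^sup>2\<close>, and \<open>1 - 2 \<eta> = \<eta>\<^sup>2\<close> for \<open>\<eta> = sqrt 2 - 1\<close>, so \<open>\<sigma>' \<ge> \<eta> \<sigma>\<close>. If
  \<open>\<sigma> = 0\<close> then \<open>\<beta>0 = \<beta>hat = 0\<close> and there is nothing to prove. Otherwise \<open>\<sigma>' > 0\<close>, and the
  first-order optimality condition at \<open>\<beta>hat\<close> is that of the Lasso with tuning parameter
  \<open>lam \<sigma>'\<close>. With \<open>t = \<sigma>' / (\<eta> \<sigma>) \<ge> 1\<close>, the usual sharp oracle argument
  for the Lasso applies with all constants multiplied by \<open>t\<close>.\<close>

lemma norm_n_sq: "(norm_n v)\<^sup>2 = (v \<bullet> v) / real CARD('n)"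
  for v :: "real ^ 'n"
  by (simp add: norm_n_def)

lemma norm_n_nonneg: "0 \<le> norm_n v"
  by (simp add: norm_n_def)

lemma norm_n_zero: "norm_n 0 = 0"
  by (simp add: norm_n_def)

lemma norm_n_eq_0_iff: "norm_n v = 0 \<longleftrightarrow> v = 0"
  by (simp add: norm_n_def)

lemma norm_n_scaleR: "norm_n (c *\<^sub>R v) = \<bar>c\<bar> * norm_n v"
proof -
  have "(norm_n (c *\<^sub>R v))\<^sup>2 = (\<bar>c\<bar> * norm_n v)\<^sup>2"
    by (simp add: norm_n_sq power_mult_distrib) (simp add: power2_eq_square)
  then show ?thesis
    by (simp add: norm_n_nonneg)
qed

lemma norm_n_diff_sq:
  "(norm_n (v - w))\<^sup>2 = (norm_n v)\<^sup>2 - 2 * (v \<bullet> w) / real CARD('n) + (norm_n w)\<^sup>2"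
  for v w :: "real ^ 'n"
  by (simp add: norm_n_sq inner_diff_left inner_diff_right inner_commute field_simps)

lemma norm_l1_nonneg: "0 \<le> norm_l1 b"
  by (simp add: norm_l1_def sum_nonneg)

lemma norm_l1_zero: "norm_l1 0 = 0"
  by (simp add: norm_l1_def)

lemma norm_l1_eq_0_iff: "norm_l1 b = 0 \<longleftrightarrow> b = 0"
  by (simp add: norm_l1_def sum_nonneg_eq_0_iff vec_eq_iff)

lemma norm_l1_scaleR: "norm_l1 (c *\<^sub>R b) = \<bar>c\<bar> * norm_l1 b"
  by (simp add: norm_l1_def abs_mult sum_distrib_left)

lemma norm_l1_uminus: "norm_l1 (- b) = norm_l1 b"
  by (simp add: norm_l1_def)

lemma norm_l1_triangle: "norm_l1 (b + c) \<le> norm_l1 b + norm_l1 c"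
  by (simp add: norm_l1_def flip: sum.distrib) (intro sum_mono abs_triangle_ineq)

lemma norm_l1_triangle_diff: "norm_l1 (b - c) \<le> norm_l1 b + norm_l1 c"
  using norm_l1_triangle[of b "- c"] by (simp add: norm_l1_uminus)

lemma norm_l1_convex:
  assumes "0 \<le> h" "h \<le> 1"
  shows "norm_l1 (b + h *\<^sub>R (c - b)) \<le> (1 - h) * norm_l1 b + h * norm_l1 c"
proof -
  have "b + h *\<^sub>R (c - b) = (1 - h) *\<^sub>R b + h *\<^sub>R c"
    by (simp add: algebra_simps)
  then show ?thesis
    using norm_l1_triangle[of "(1 - h) *\<^sub>R b" "h *\<^sub>R c"] assms by (simp add: norm_l1_scaleR)
qed

lemma restrict_vec_scaleR: "restrict_vec (c *\<^sub>R b) S = c *\<^sub>R restrict_vec b S"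
  by (simp add: restrict_vec_def vec_eq_iff)

lemma restrict_vec_restrict_vec: "restrict_vec (restrict_vec b S) T = restrict_vec b (S \<inter> T)"
  by (simp add: restrict_vec_def vec_eq_iff)

lemma restrict_vec_diff: "restrict_vec (b - c) S = restrict_vec b S - restrict_vec c S"
  by (simp add: restrict_vec_def vec_eq_iff)

lemma restrict_vec_empty: "restrict_vec b {} = 0"
  by (simp add: restrict_vec_def vec_eq_iff)

lemma restrict_vec_split: "restrict_vec b S + restrict_vec b (- S) = b"
  by (simp add: restrict_vec_def vec_eq_iff)

lemma norm_l1_split: "norm_l1 b = norm_l1 (restrict_vec b S) + norm_l1 (restrict_vec b (- S))"
  unfolding norm_l1_def sum.distrib[symmetric]
  by (rule sum.cong) (auto simp: restrict_vec_def)

lemma norm_l1_diff_ge: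
  "norm_l1 b - norm_l1 c
    \<ge> norm_l1 (restrict_vec (b - c) (- active_set c)) - norm_l1 (restrict_vec (b - c) (active_set c))"
  unfolding norm_l1_def sum_subtractf[symmetric]
  by (rule sum_mono) (auto simp: restrict_vec_def active_set_def)

lemma abs_inner_le_infnorm_norm_l1: "\<bar>v \<bullet> b\<bar> \<le> infnorm v * norm_l1 b"
proof -
  have "\<bar>v \<bullet> b\<bar> \<le> (\<Sum>j\<in>UNIV. \<bar>v $ j\<bar> * \<bar>b $ j\<bar>)"
    using sum_abs[of "\<lambda>j. v $ j * b $ j" UNIV] by (simp add: inner_vec_def abs_mult)
  also have "\<dots> \<le> (\<Sum>j\<in>UNIV. infnorm v * \<bar>b $ j\<bar>)"
    by (intro sum_mono mult_right_mono component_le_infnorm_cart) auto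
  finally show ?thesis
    by (simp add: norm_l1_def sum_distrib_left)
qed

lemma noise_bound:
  fixes X :: "real ^ 'p ^ 'n"
  assumes "infnorm (\<epsilon> v* X) / real CARD('n) \<le> M"
  shows "\<bar>\<epsilon> \<bullet> (X *v b)\<bar> / real CARD('n) \<le> M * norm_l1 b"
proof -
  have "\<epsilon> \<bullet> (X *v b) = (\<epsilon> v* X) \<bullet> b"
    by (simp add: dot_lmul_matrix)
  then have "\<bar>\<epsilon> \<bullet> (X *v b)\<bar> / real CARD('n) \<le> infnorm (\<epsilon> v* X) / real CARD('n) * norm_l1 b"
    using abs_inner_le_infnorm_norm_l1[of "\<epsilon> v* X" b] by (simp add: divide_right_mono)
  also have "\<dots> \<le> M * norm_l1 b"
    by (intro mult_right_mono assms norm_l1_nonneg)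
  finally show ?thesis .
qed

lemma compat_sq_nonneg:
  assumes "S \<noteq> {}" "0 \<le> L"
  shows "0 \<le> compat_sq X L S"
proof -
  obtain j where j: "j \<in> S"
    using assms by auto
  have "restrict_vec (axis j 1) S = axis j (1 :: real)" "restrict_vec (axis j 1) (- S) = 0"
    using j by (auto simp: restrict_vec_def vec_eq_iff axis_def)
  moreover have "norm_l1 (axis j 1) = 1"
    by (simp add: norm_l1_def axis_def if_distrib cong: if_cong)
  ultimately have "\<exists>b. norm_l1 (restrict_vec b S) = 1 \<and> norm_l1 (restrict_vec b (- S)) \<le> L"
    using assms by (intro exI[of _ "axis j 1"]) (simp add: norm_l1_zero)
  then show ?thesis
    unfolding compat_sq_def by (intro cInf_greatest) auto
qed

lemma compat_sq_le:
  assumes "norm_l1 (restrict_vec b S) = 1" "norm_l1 (restrict_vec b (- S)) \<le> L"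
  shows "compat_sq X L S
    \<le> real (card S) * (norm_n (X *v restrict_vec b S - X *v restrict_vec b (- S)))\<^sup>2"
  unfolding compat_sq_def
  by (rule cInf_lower) (use assms in \<open>auto intro!: bdd_belowI[of _ 0]\<close>)

lemma compat_sq_mult_le:
  assumes cone: "norm_l1 (restrict_vec d (- S)) \<le> L * norm_l1 (restrict_vec d S)"
  shows "compat_sq X L S * (norm_l1 (restrict_vec d S))\<^sup>2 \<le> real (card S) * (norm_n (X *v d))\<^sup>2"
proof (cases "norm_l1 (restrict_vec d S) = 0")
  case False
  define a where "a = norm_l1 (restrict_vec d S)"
  have a: "a > 0"
    using False norm_l1_nonneg[of "restrict_vec d S"] by (simp add: a_def)
  define b where "b = (1 / a) *\<^sub>R (restrict_vec d S - restrict_vec d (- S))"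
  have bS: "restrict_vec b S = (1 / a) *\<^sub>R restrict_vec d S"
    by (simp add: b_def restrict_vec_scaleR restrict_vec_diff restrict_vec_restrict_vec
        restrict_vec_empty)
  have bSc: "restrict_vec b (- S) = - ((1 / a) *\<^sub>R restrict_vec d (- S))"
    by (simp add: b_def restrict_vec_scaleR restrict_vec_diff restrict_vec_restrict_vec
        restrict_vec_empty)
  have "restrict_vec b S - restrict_vec b (- S) = (1 / a) *\<^sub>R d"
    unfolding bS bSc by (simp add: restrict_vec_split flip: scaleR_right_distrib)
  then have eq: "X *v restrict_vec b S - X *v restrict_vec b (- S) = (1 / a) *\<^sub>R (X *v d)"
    by (simp add: matrix_vector_mult_scaleR flip: matrix_vector_mult_diff_distrib)
  have "norm_l1 (restrict_vec b S) = 1"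
    unfolding bS norm_l1_scaleR using a by (simp add: a_def)
  moreover have "norm_l1 (restrict_vec b (- S)) \<le> L"
    unfolding bSc norm_l1_uminus norm_l1_scaleR using a cone by (simp add: a_def field_simps)
  ultimately have "compat_sq X L S \<le> real (card S) * (norm_n ((1 / a) *\<^sub>R (X *v d)))\<^sup>2"
    using compat_sq_le[of b S L X] by (simp only: eq)
  then show ?thesis
    using a by (simp add: norm_n_scaleR power_mult_distrib power_divide field_simps flip: a_def)
qed simp

lemma sqrt_lasso_le:
  assumes "is_sqrt_lasso X Y lam \<beta>hat"
  shows "norm_n (Y - X *v \<beta>hat) + lam * norm_l1 \<beta>hat \<le> norm_n (Y - X *v b) + lam * norm_l1 b"
  using assms by (simp add: is_sqrt_lasso_def is_arg_min_linorder)

lemma sqrt_lasso_optimality: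
  fixes X :: "real ^ 'p ^ 'n"
  assumes bhat: "is_sqrt_lasso X Y lam \<beta>hat" and lam: "0 \<le> lam"
    and pos: "0 < norm_n (Y - X *v \<beta>hat)"
  shows "lam * norm_n (Y - X *v \<beta>hat) * (norm_l1 \<beta>hat - norm_l1 b)
    \<le> ((Y - X *v \<beta>hat) \<bullet> (X *v (\<beta>hat - b))) / real CARD('n)"
proof -
  define r where "r = Y - X *v \<beta>hat"
  define u where "u = X *v (b - \<beta>hat)"
  define s where "s = norm_n r"
  define ip where "ip = (r \<bullet> u) / real CARD('n)"
  have s: "s > 0"
    using pos by (simp add: s_def r_def)
  have step: "2 * (lam * s * (norm_l1 \<beta>hat - norm_l1 b) + ip) \<le> h * (norm_n u)\<^sup>2"
    if h: "0 < h" "h \<le> 1" for h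
  proof -
    define w where "w = norm_n (r - h *\<^sub>R u)"
    have res: "Y - X *v (\<beta>hat + h *\<^sub>R (b - \<beta>hat)) = r - h *\<^sub>R u"
      by (simp add: r_def u_def matrix_vector_right_distrib matrix_vector_mult_scaleR algebra_simps)
    have "s + lam * norm_l1 \<beta>hat \<le> w + lam * norm_l1 (\<beta>hat + h *\<^sub>R (b - \<beta>hat))"
      using sqrt_lasso_le[OF bhat, of "\<beta>hat + h *\<^sub>R (b - \<beta>hat)"] unfolding res
      by (simp add: s_def w_def r_def)
    also have "\<dots> \<le> w + lam * ((1 - h) * norm_l1 \<beta>hat + h * norm_l1 b)"
      by (intro add_left_mono mult_left_mono norm_l1_convex lam) (use h in auto)
    finally have "lam * h * (norm_l1 \<beta>hat - norm_l1 b) \<le> w - s"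
      by (simp add: algebra_simps)
    then have "2 * s * (lam * h * (norm_l1 \<beta>hat - norm_l1 b)) \<le> 2 * s * (w - s)"
      using s by (intro mult_left_mono) auto
    also have "\<dots> \<le> w\<^sup>2 - s\<^sup>2"
      using zero_le_power2[of "w - s"] by (simp add: power2_eq_square algebra_simps)
    also have "\<dots> = h * (- 2 * ip + h * (norm_n u)\<^sup>2)"
    proof -
      have "w\<^sup>2 = s\<^sup>2 - 2 * h * ip + h\<^sup>2 * (norm_n u)\<^sup>2"
        by (simp add: w_def s_def ip_def norm_n_diff_sq norm_n_scaleR power_mult_distrib)
      then show ?thesis
        by (simp add: power2_eq_square algebra_simps)
    qed
    finally have "h * (2 * (lam * s * (norm_l1 \<beta>hat - norm_l1 b) + ip)) \<le> h * (h * (norm_n u)\<^sup>2)"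
      by (simp add: algebra_simps)
    then show ?thesis
      using h by simp
  qed
  have "((\<lambda>h. h * (norm_n u)\<^sup>2) \<longlongrightarrow> 0 * (norm_n u)\<^sup>2) (at_right 0)"
    by (intro tendsto_intros)
  moreover have "eventually (\<lambda>h::real. 0 < h \<and> h \<le> 1) (at_right 0)"
    by (auto simp: eventually_at_right_field intro!: exI[of _ 1])
  then have "eventually (\<lambda>h. 2 * (lam * s * (norm_l1 \<beta>hat - norm_l1 b) + ip) \<le> h * (norm_n u)\<^sup>2)
      (at_right 0)"
    by eventually_elim (use step in auto)
  ultimately have "2 * (lam * s * (norm_l1 \<beta>hat - norm_l1 b) + ip) \<le> 0 * (norm_n u)\<^sup>2"
    by (rule tendsto_lowerbound) simp
  moreover have "ip = - ((r \<bullet> (X *v (\<beta>hat - b))) / real CARD('n))"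
    by (simp add: ip_def u_def matrix_vector_mult_diff_distrib inner_diff_right field_simps)
  ultimately show ?thesis
    by (simp add: s_def r_def)
qed

lemma sqrt_lasso_residual_le:
  assumes bhat: "is_sqrt_lasso X Y lam \<beta>hat" and lam: "0 < lam"
    and small: "norm_l1 \<beta>0 \<le> norm_n (Y - X *v \<beta>0) * ((lam * \<eta> - lam0) / (2 * lam0 * lam))"
    and lam0: "lam0 > 0"
  shows "norm_n (Y - X *v \<beta>hat) \<le> norm_n (Y - X *v \<beta>0) * ((lam * \<eta> + lam0) / (2 * lam0))"
proof -
  have "norm_n (Y - X *v \<beta>hat) \<le> norm_n (Y - X *v \<beta>0) + lam * norm_l1 \<beta>0"
    using sqrt_lasso_le[OF bhat, of \<beta>0] mult_nonneg_nonneg[of lam "norm_l1 \<beta>hat"] lam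
      norm_l1_nonneg[of \<beta>hat] by linarith
  also have "\<dots> \<le> norm_n (Y - X *v \<beta>0)
      + lam * (norm_n (Y - X *v \<beta>0) * ((lam * \<eta> - lam0) / (2 * lam0 * lam)))"
    by (intro add_left_mono mult_left_mono small) (use lam in auto)
  also have "\<dots> = norm_n (Y - X *v \<beta>0) * ((lam * \<eta> + lam0) / (2 * lam0))"
    using lam lam0 by (simp add: field_simps)
  finally show ?thesis .
qed

lemma sqrt_lasso_residual_ge:
  fixes X :: "real ^ 'p ^ 'n"
  assumes bhat: "is_sqrt_lasso X Y lam \<beta>hat" and lam: "0 < lam" and lam0: "lam0 > 0"
    and noise: "infnorm ((Y - X *v \<beta>0) v* X) / real CARD('n) \<le> lam0 * norm_n (Y - X *v \<beta>0)"
    and small: "norm_l1 \<beta>0 \<le> norm_n (Y - X *v \<beta>0) * ((lam * \<eta> - lam0) / (2 * lam0 * lam))"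
    and eta: "\<eta> = sqrt 2 - 1"
  shows "\<eta> * norm_n (Y - X *v \<beta>0) \<le> norm_n (Y - X *v \<beta>hat)"
proof -
  define \<epsilon> where "\<epsilon> = Y - X *v \<beta>0"
  define s where "s = norm_n \<epsilon>"
  define s' where "s' = norm_n (Y - X *v \<beta>hat)"
  define d where "d = \<beta>hat - \<beta>0"
  have nn: "s \<ge> 0" "s' \<ge> 0"
    by (simp_all add: s_def s'_def norm_n_nonneg)
  have res: "Y - X *v \<beta>hat = \<epsilon> - X *v d"
    by (simp add: \<epsilon>_def d_def matrix_vector_mult_diff_distrib)
  have "lam * norm_l1 d \<le> lam * (norm_l1 \<beta>hat + norm_l1 \<beta>0)"
    using lam norm_l1_triangle_diff[of \<beta>hat \<beta>0] by (simp add: d_def)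
  also have "\<dots> \<le> s - s' + 2 * (lam * norm_l1 \<beta>0)"
    using sqrt_lasso_le[OF bhat, of \<beta>0] by (simp add: s_def s'_def \<epsilon>_def algebra_simps)
  also have "\<dots> \<le> s - s' + 2 * (lam * (s * ((lam * \<eta> - lam0) / (2 * lam0 * lam))))"
    unfolding s_def \<epsilon>_def by (intro add_left_mono mult_left_mono small) (use lam in auto)
  finally have "lam0 * (lam * norm_l1 d)
      \<le> lam0 * (s - s' + 2 * (lam * (s * ((lam * \<eta> - lam0) / (2 * lam0 * lam)))))"
    using lam0 by simp
  also have "\<dots> = lam * \<eta> * s - lam0 * s'"
    using lam lam0 by (simp add: field_simps)
  finally have "lam * (lam0 * norm_l1 d) \<le> lam * (\<eta> * s)"
    using mult_nonneg_nonneg[OF less_imp_le[OF lam0] nn(2)] by (simp only: mult_ac)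
  then have d_le: "lam0 * norm_l1 d \<le> \<eta> * s"
    using lam by simp
  have eta_sq: "\<eta>\<^sup>2 = 1 - 2 * \<eta>"
    by (simp add: eta power2_eq_square algebra_simps)
  have "\<bar>\<epsilon> \<bullet> (X *v d)\<bar> / real CARD('n) \<le> lam0 * s * norm_l1 d"
    using noise_bound[OF noise, of d] by (simp add: s_def \<epsilon>_def)
  moreover have "(\<epsilon> \<bullet> (X *v d)) / real CARD('n) \<le> \<bar>\<epsilon> \<bullet> (X *v d)\<bar> / real CARD('n)"
    by (intro divide_right_mono) auto
  moreover have "lam0 * s * norm_l1 d \<le> s * (\<eta> * s)"
    using mult_left_mono[OF d_le nn(1)] by (simp add: algebra_simps)
  moreover have "s'\<^sup>2 = s\<^sup>2 - 2 * ((\<epsilon> \<bullet> (X *v d)) / real CARD('n)) + (norm_n (X *v d))\<^sup>2"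
    unfolding s'_def res norm_n_diff_sq by (simp add: s_def)
  ultimately have "s'\<^sup>2 \<ge> s\<^sup>2 - 2 * (s * (\<eta> * s))"
    using zero_le_power2[of "norm_n (X *v d)"] by linarith
  then have "(\<eta> * s)\<^sup>2 \<le> s'\<^sup>2"
    by (simp add: power_mult_distrib eta_sq) (simp add: algebra_simps power2_eq_square)
  then show ?thesis
    using nn by (auto intro: power2_le_imp_le simp: s_def s'_def \<epsilon>_def)
qed

lemma two_point_identity:
  fixes X :: "real ^ 'p ^ 'n"
  shows "2 * (((X *v (c - b0)) \<bullet> (X *v (c - b))) / real CARD('n))
    = (norm_n (X *v (c - b)))\<^sup>2 + (norm_n (X *v (c - b0)))\<^sup>2 - (norm_n (X *v (b - b0)))\<^sup>2"
proof -
  have "X *v (b - b0) = X *v (c - b0) - X *v (c - b)"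
    by (simp add: matrix_vector_mult_diff_distrib)
  then show ?thesis
    by (simp only: norm_n_diff_sq)
qed

text \<open>For empty \<open>S\<close> the last summand vanishes, whatever the junk value of \<open>compat_sq\<close> is.\<close>

lemma lasso_oracle:
  fixes X :: "real ^ 'p ^ 'n"
  defines "N \<equiv> real CARD('n)"
  assumes opt: "((X *v (c - b0)) \<bullet> (X *v (c - b))) / N \<le>
        m * norm_l1 (c - b) - k * (norm_l1 c - norm_l1 b)"
    and A: "0 < A" "0 \<le> B" and t: "1 \<le> t" and delta: "0 \<le> \<delta>" "\<delta> < 1"
    and k: "0 \<le> k" "t * A \<le> k - m" "k + m \<le> t * B"
    and S: "S = active_set b"
    and phi: "S \<noteq> {} \<Longrightarrow> 0 < compat_sq X ((B + \<delta> * A) / ((1 - \<delta>) * A)) S"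
  shows "2 * \<delta> * A * norm_l1 (c - b0) + (norm_n (X *v (c - b0)))\<^sup>2
    \<le> 2 * \<delta> * A * norm_l1 (b - b0) + (norm_n (X *v (b - b0)))\<^sup>2
      + (t * (B + \<delta> * A))\<^sup>2 * (real (card S) / compat_sq X ((B + \<delta> * A) / ((1 - \<delta>) * A)) S)"
proof -
  define d where "d = c - b"
  define x where "x = norm_l1 (restrict_vec d S)"
  define y where "y = norm_l1 (restrict_vec d (- S))"
  define L where "L = (B + \<delta> * A) / ((1 - \<delta>) * A)"
  define \<phi> where "\<phi> = compat_sq X L S"
  define I where "I = ((X *v (c - b0)) \<bullet> (X *v d)) / N"
  define z where "z = norm_n (X *v d)"
  define T where "T = t * (B + \<delta> * A)"
  define K where "K = real (card S) / \<phi>"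
  have xy: "norm_l1 d = x + y"
    unfolding x_def y_def by (rule norm_l1_split)
  have nn: "0 \<le> x" "0 \<le> y" "0 \<le> z" "0 \<le> T"
    using A t delta by (simp_all add: x_def y_def z_def T_def norm_l1_nonneg norm_n_nonneg)
  have ident: "2 * I = z\<^sup>2 + (norm_n (X *v (c - b0)))\<^sup>2 - (norm_n (X *v (b - b0)))\<^sup>2"
    unfolding I_def z_def d_def N_def by (rule two_point_identity)
  have "I \<le> m * (x + y) - k * (y - x)"
  proof -
    have "k * (y - x) \<le> k * (norm_l1 c - norm_l1 b)"
      using norm_l1_diff_ge[of c b] k by (intro mult_left_mono) (auto simp: x_def y_def d_def S)
    then show ?thesis
      using opt xy by (simp add: I_def d_def)
  qed
  moreover have "(t * A) * y \<le> (k - m) * y" "(k + m) * x \<le> (t * B) * x"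
    using k nn by (auto intro: mult_right_mono)
  ultimately have main: "I + t * A * y \<le> t * B * x"
    by (simp add: algebra_simps)
  have K: "0 \<le> K"
    using phi by (cases "S = {}") (auto simp: K_def \<phi>_def L_def less_imp_le)
  have "2 * (I + \<delta> * A * (x + y)) \<le> z\<^sup>2 + T\<^sup>2 * K"
  proof (cases "I + \<delta> * A * (x + y) \<le> 0")
    case True
    moreover have "0 \<le> z\<^sup>2 + T\<^sup>2 * K"
      using K by simp
    ultimately show ?thesis
      by (meson mult_nonneg_nonpos order_trans zero_le_numeral)
  next
    case False
    have dt: "\<delta> * A * (x + y) \<le> t * (\<delta> * A * (x + y))"
      using t A delta nn by (intro mult_right_mono[of 1 t, simplified]) auto
    with False main have "t * A * y \<le> t * B * x + t * (\<delta> * A * (x + y))"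
      by linarith
    then have "t * ((1 - \<delta>) * A * y) \<le> t * ((B + \<delta> * A) * x)"
      by (simp add: algebra_simps)
    then have "(1 - \<delta>) * A * y \<le> (B + \<delta> * A) * x"
      using t by simp
    then have cone: "y \<le> L * x"
      using A delta by (simp add: L_def field_simps)
    have "t * A * y \<ge> t * (\<delta> * A * y)"
      using t A delta nn mult_right_mono[of \<delta> 1 "t * A * y"] by (simp add: algebra_simps)
    then have upper: "I + \<delta> * A * (x + y) \<le> T * x"
      using main dt by (simp add: T_def algebra_simps)
    have "x\<^sup>2 \<le> K * z\<^sup>2"
    proof (cases "S = {}")
      case True
      then have "x = 0"
        by (simp add: x_def restrict_vec_empty norm_l1_eq_0_iff)
      then show ?thesis
        using K by simp
    next
      case False
      have "\<phi> * x\<^sup>2 \<le> real (card S) * z\<^sup>2"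
        using compat_sq_mult_le[of d S L X] cone by (simp add: \<phi>_def x_def y_def z_def)
      then show ?thesis
        using phi[OF False, folded L_def \<phi>_def] by (simp add: K_def field_simps)
    qed
    then have "x \<le> sqrt (K * z\<^sup>2)"
      by (rule real_le_rsqrt)
    then have "x \<le> sqrt K * z"
      using nn by (simp add: real_sqrt_mult)
    then have "T * x \<le> T * (sqrt K * z)"
      using nn by (intro mult_left_mono) auto
    with upper have "I + \<delta> * A * (x + y) \<le> T * (sqrt K * z)"
      by (rule order_trans)
    then have "2 * (I + \<delta> * A * (x + y)) \<le> 2 * (T * (sqrt K * z))"
      by (rule mult_left_mono) simp
    also have "2 * (T * (sqrt K * z)) \<le> z\<^sup>2 + T\<^sup>2 * K"
      using sum_squares_bound[of z "T * sqrt K"] K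
      by (simp add: power_mult_distrib algebra_simps)
    finally show ?thesis .
  qed
  moreover have "\<delta> * A * norm_l1 (c - b0) \<le> \<delta> * A * (x + y + norm_l1 (b - b0))"
    using A delta norm_l1_triangle[of "c - b" "b - b0"] xy
    by (intro mult_left_mono) (auto simp: d_def)
  ultimately show ?thesis
    unfolding L_def[symmetric] \<phi>_def[symmetric] K_def[symmetric] T_def[symmetric]
    using ident unfolding mult.assoc distrib_left by linarith
qed

lemma sqrt_lasso_oracle:
  fixes X :: "real ^ 'p ^ 'n"
  assumes bhat: "is_sqrt_lasso X Y lam \<beta>hat" and lam: "0 < lam" and lam0: "lam0 > 0"
    and noise: "infnorm ((Y - X *v \<beta>0) v* X) / real CARD('n) \<le> lam0 * norm_n (Y - X *v \<beta>0)"
    and small: "norm_l1 \<beta>0 \<le> norm_n (Y - X *v \<beta>0) * ((lam * \<eta> - lam0) / (2 * lam0 * lam))"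
    and eta: "\<eta> = sqrt 2 - 1" and lam_eta: "lam0 < lam * \<eta>"
    and delta: "0 \<le> \<delta>" "\<delta> < 1"
    and L: "L = (lam * \<eta> + lam0 + \<delta> * (lam * \<eta> - lam0)) / ((1 - \<delta>) * (lam * \<eta> - lam0))"
    and phi: "active_set b \<noteq> {} \<Longrightarrow> 0 < compat_sq X L (active_set b)"
  shows "2 * \<delta> * (lam * \<eta> - lam0) * norm_n (Y - X *v \<beta>0) * norm_l1 (\<beta>hat - \<beta>0)
      + (norm_n (X *v (\<beta>hat - \<beta>0)))\<^sup>2
    \<le> 2 * \<delta> * (lam * \<eta> - lam0) * norm_n (Y - X *v \<beta>0) * norm_l1 (b - \<beta>0)
      + (norm_n (X *v (b - \<beta>0)))\<^sup>2
      + ((lam * \<eta> + lam0 + \<delta> * (lam * \<eta> - lam0)) / \<eta>)\<^sup>2 * ((lam * \<eta> + lam0) / (2 * lam0))\<^sup>2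
        * (norm_n (Y - X *v \<beta>0))\<^sup>2
        * (real (card (active_set b)) / compat_sq X L (active_set b))"
proof -
  define s where "s = norm_n (Y - X *v \<beta>0)"
  define s' where "s' = norm_n (Y - X *v \<beta>hat)"
  define K where "K = real (card (active_set b)) / compat_sq X L (active_set b)"
  define G where "G = lam * \<eta> + lam0 + \<delta> * (lam * \<eta> - lam0)"
  have K: "0 \<le> K"
    using phi by (cases "active_set b = {}") (auto simp: K_def less_imp_le)
  have eta_pos: "\<eta> > 0"
    by (simp add: eta)
  have upper: "s' \<le> s * ((lam * \<eta> + lam0) / (2 * lam0))"
    unfolding s_def s'_def by (rule sqrt_lasso_residual_le[OF bhat lam small lam0])
  have lower: "\<eta> * s \<le> s'"
    unfolding s_def s'_def by (rule sqrt_lasso_residual_ge[OF bhat lam lam0 noise small eta])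
  show ?thesis
  proof (cases "s = 0")
    case True
    then have "norm_l1 \<beta>0 = 0"
      using small norm_l1_nonneg[of \<beta>0] by (simp add: s_def)
    moreover have "Y - X *v \<beta>0 = 0"
      using True by (simp add: s_def norm_n_eq_0_iff)
    ultimately have "\<beta>0 = 0" "Y = 0"
      by (auto simp: norm_l1_eq_0_iff)
    moreover from this have "lam * norm_l1 \<beta>hat \<le> 0"
      using sqrt_lasso_le[OF bhat, of 0] norm_n_nonneg[of "Y - X *v \<beta>hat"]
      by (simp add: norm_n_zero norm_l1_zero)
    then have "\<beta>hat = 0"
      using lam norm_l1_nonneg[of \<beta>hat] by (simp add: mult_le_0_iff flip: norm_l1_eq_0_iff)
    ultimately show ?thesis
      by (simp add: norm_n_zero)
  next
    case False
    then have s: "s > 0"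
      using norm_n_nonneg[of "Y - X *v \<beta>0"] by (simp add: s_def)
    then have s': "s' > 0"
      using lower eta_pos mult_pos_pos[of \<eta> s] by linarith
    define t where "t = s' / (\<eta> * s)"
    have t: "1 \<le> t"
      using lower s eta_pos by (simp add: t_def)
    have ts: "t * s * \<eta> = s'"
      using s eta_pos by (simp add: t_def)
    have lam0_t: "lam0 * s \<le> t * (lam0 * s)"
      using t lam0 s by simp
    have "(Y - X *v \<beta>hat) \<bullet> (X *v (\<beta>hat - b)) =
        (Y - X *v \<beta>0) \<bullet> (X *v (\<beta>hat - b)) - (X *v (\<beta>hat - \<beta>0)) \<bullet> (X *v (\<beta>hat - b))"
      by (simp add: matrix_vector_mult_diff_distrib inner_diff_left)
    moreover have "((Y - X *v \<beta>0) \<bullet> (X *v (\<beta>hat - b))) / real CARD('n)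
        \<le> \<bar>(Y - X *v \<beta>0) \<bullet> (X *v (\<beta>hat - b))\<bar> / real CARD('n)"
      by (intro divide_right_mono) auto
    ultimately have "((X *v (\<beta>hat - \<beta>0)) \<bullet> (X *v (\<beta>hat - b))) / real CARD('n)
        \<le> lam0 * s * norm_l1 (\<beta>hat - b) - lam * s' * (norm_l1 \<beta>hat - norm_l1 b)"
      using sqrt_lasso_optimality[OF bhat, of b] lam s' noise_bound[OF noise, of "\<beta>hat - b"]
      by (simp add: s_def s'_def diff_divide_distrib)
    moreover have "(s * (lam * \<eta> + lam0) + \<delta> * (s * (lam * \<eta> - lam0)))
        / ((1 - \<delta>) * (s * (lam * \<eta> - lam0))) = L"
    proof -
      have "s * (lam * \<eta> + lam0) + \<delta> * (s * (lam * \<eta> - lam0)) = s * G"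
        "(1 - \<delta>) * (s * (lam * \<eta> - lam0)) = s * ((1 - \<delta>) * (lam * \<eta> - lam0))"
        by (simp_all add: G_def algebra_simps)
      then show ?thesis
        using s by (simp add: L G_def)
    qed
    ultimately have "2 * \<delta> * (s * (lam * \<eta> - lam0)) * norm_l1 (\<beta>hat - \<beta>0)
        + (norm_n (X *v (\<beta>hat - \<beta>0)))\<^sup>2
      \<le> 2 * \<delta> * (s * (lam * \<eta> - lam0)) * norm_l1 (b - \<beta>0) + (norm_n (X *v (b - \<beta>0)))\<^sup>2
        + (t * (s * (lam * \<eta> + lam0) + \<delta> * (s * (lam * \<eta> - lam0))))\<^sup>2 * K"
      using lasso_oracle[of X \<beta>hat \<beta>0 b "lam0 * s" "lam * s'" "s * (lam * \<eta> - lam0)"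
          "s * (lam * \<eta> + lam0)" t \<delta> "active_set b"]
        lam lam0 s s' lam_eta t delta phi lam0_t
      by (simp add: K_def flip: ts) (simp add: algebra_simps)
    also have "t * (s * (lam * \<eta> + lam0) + \<delta> * (s * (lam * \<eta> - lam0))) = G / \<eta> * s'"
    proof -
      have "G / \<eta> * s' = t * s * G"
        using eta_pos by (simp flip: ts)
      then show ?thesis
        by (simp add: G_def algebra_simps)
    qed
    also have "(G / \<eta> * s')\<^sup>2 * K
        \<le> (G / \<eta>)\<^sup>2 * (s * ((lam * \<eta> + lam0) / (2 * lam0)))\<^sup>2 * K"
      unfolding power_mult_distrib[of "G / \<eta>"] using upper s' K
      by (intro mult_right_mono mult_left_mono power_mono) auto
    finally show ?thesis
      unfolding s_def[symmetric] K_def[symmetric] G_def[symmetric]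
      by (simp add: power_mult_distrib power_divide mult_ac)
  qed
qed

theorem theorem1p4p2:
  fixes X :: "real ^ 'p ^ 'n"
    and Y f0 \<epsilon> :: "real ^ 'n"
    and \<beta>0 \<beta>hat :: "real ^ 'p"
    and lam lam0 \<eta> \<delta> L :: real
  assumes rank_X: "rank X = CARD('n)"
    and beta0: "X *v \<beta>0 = f0"
    and eps: "\<epsilon> = Y - f0"
    and lam: "lam > 0"
    and bhat: "is_sqrt_lasso X Y lam \<beta>hat"
    and lam0: "lam0 > 0"
    and noise: "lam0 * norm_n \<epsilon> \<ge> infnorm (\<epsilon> v* X) / real CARD('n)"
    and eta: "\<eta> = sqrt 2 - 1"
    and lam_eta: "lam * \<eta> > lam0"
    and beta0_small: "norm_l1 \<beta>0 \<le> norm_n \<epsilon> * ((lam * \<eta> - lam0) / (2 * lam0 * lam))"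
    and delta: "0 \<le> \<delta>" "\<delta> < 1"
    and L: "L = (lam * \<eta> + lam0 + \<delta> * (lam * \<eta> - lam0)) / ((1 - \<delta>) * (lam * \<eta> - lam0))"
  shows "ereal (2 * \<delta> * (lam * \<eta> - lam0) * norm_n \<epsilon> * norm_l1 (\<beta>hat - \<beta>0)
                + (norm_n (X *v (\<beta>hat - \<beta>0)))\<^sup>2)
    \<le> (INF S::'p set.
          (INF \<beta>\<in>{\<beta>. active_set \<beta> = S}.
             ereal (2 * \<delta> * (lam * \<eta> - lam0) * norm_n \<epsilon> * norm_l1 (\<beta> - \<beta>0)
                    + (norm_n (X *v (\<beta> - \<beta>0)))\<^sup>2))
          + compat_term
              (((lam * \<eta> + lam0 + \<delta> * (lam * \<eta> - lam0)) / \<eta>)\<^sup>2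
               * ((lam * \<eta> + lam0) / (2 * lam0))\<^sup>2 * (norm_n \<epsilon>)\<^sup>2) X L S)"
proof (rule INF_greatest)
  fix S :: "'p set"
  let ?c = "((lam * \<eta> + lam0 + \<delta> * (lam * \<eta> - lam0)) / \<eta>)\<^sup>2
               * ((lam * \<eta> + lam0) / (2 * lam0))\<^sup>2 * (norm_n \<epsilon>)\<^sup>2"
  let ?lhs = "2 * \<delta> * (lam * \<eta> - lam0) * norm_n \<epsilon> * norm_l1 (\<beta>hat - \<beta>0)
                + (norm_n (X *v (\<beta>hat - \<beta>0)))\<^sup>2"
  let ?g = "\<lambda>\<beta>. 2 * \<delta> * (lam * \<eta> - lam0) * norm_n \<epsilon> * norm_l1 (\<beta> - \<beta>0)
                    + (norm_n (X *v (\<beta> - \<beta>0)))\<^sup>2"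
  let ?r = "?c * (real (card S) / compat_sq X L S)"
  have eps': "\<epsilon> = Y - X *v \<beta>0"
    by (simp add: eps beta0)
  have "L \<ge> 0"
    using lam_eta lam0 delta by (simp add: L)
  show "ereal ?lhs \<le> (INF \<beta>\<in>{\<beta>. active_set \<beta> = S}. ereal (?g \<beta>)) + compat_term ?c X L S"
  proof (cases "S \<noteq> {} \<and> compat_sq X L S = 0")
    case True
    then show ?thesis
      by (simp add: compat_term_def)
  next
    case False
    then have phi: "S \<noteq> {} \<Longrightarrow> 0 < compat_sq X L S"
      using compat_sq_nonneg[OF _ \<open>L \<ge> 0\<close>, of S X] by force
    have ct: "compat_term ?c X L S = ereal ?r"
      using False by (auto simp: compat_term_def)
    have "ereal (?lhs - ?r) \<le> (INF \<beta>\<in>{\<beta>. active_set \<beta> = S}. ereal (?g \<beta>))"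
    proof (rule INF_greatest)
      fix \<beta> :: "real ^ 'p"
      assume "\<beta> \<in> {\<beta>. active_set \<beta> = S}"
      then have "?lhs \<le> ?g \<beta> + ?r"
        using sqrt_lasso_oracle[OF bhat lam lam0 noise[unfolded eps'] beta0_small[unfolded eps']
            eta lam_eta delta L, of \<beta>] phi
        by (simp add: eps')
      then show "ereal (?lhs - ?r) \<le> ereal (?g \<beta>)"
        by simp
    qed
    from add_right_mono[OF this, of "ereal ?r"] show ?thesis
      unfolding ct by simp
  qed
qed

end
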